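(* Let $(X, \|\cdot\|)$ be a real normed space of dimension at least $2$, and let $\lambda \in (0, 1]$. The following conditions are equivalent: (i) $\perp_{\rho_+} \subseteq \perp_{\rho_{\lambda}}$. (ii) $\perp_{\rho_{\lambda}}\subseteq\perp_{\rho_+}$. (iii) $\perp_{\rho_{\lambda}} = \perp_{\rho_+}$. (iv) $X$ is smooth.
   Context: For a real normed space $X$ and $x,y\in X$, the norm derivatives are $\rho_{-}(x,y):=\|x\|\lim_{t\to 0^{-}}\frac{\|x+ty\|-\|x\|}{t}$ and $\rho_{+}(x,y):=\|x\|\lim_{t\to 0^{+}}\frac{\|x+ty\|-\|x\|}{t}$ (the limits exist by convexity of the norm). $x\perp_{\rho_+}y$ means $\rho_+(x,y)=0$. For $\lambda\in[0,1]$, $\rho_{\lambda}(x, y) := \lambda\rho_-(x,y) + (1 - \lambda)\rho_+(x,y)$, and $x\perp_{\rho_{\lambda}}y$ means $\rho_{\lambda}(x,y)=0$. Inclusions and equalities are between relations viewed as subsets of $X\times X$. A support functional at a nonzero $x\in X$ is a norm-one linear functional $F_x$ on $X$ with $F_x(x)=\|x\|$; $X$ is smooth at $x$ if there is a unique support functional at $x$, and $X$ is smooth if it is smooth at every nonzero $x\in X$. *)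

theory Defs
  imports "HOL-Analysis.Analysis"
begin

definition rho_minus :: "'a::real_normed_vector \<Rightarrow> 'a \<Rightarrow> real" where
  "rho_minus x y = norm x * Lim (at_left 0) (\<lambda>t. (norm (x + t *\<^sub>R y) - norm x) / t)"

definition rho_plus :: "'a::real_normed_vector \<Rightarrow> 'a \<Rightarrow> real" where
  "rho_plus x y = norm x * Lim (at_right 0) (\<lambda>t. (norm (x + t *\<^sub>R y) - norm x) / t)"

definition rho_lambda :: "real \<Rightarrow> 'a::real_normed_vector \<Rightarrow> 'a \<Rightarrow> real" where
  "rho_lambda l x y = l * rho_minus x y + (1 - l) * rho_plus x y"

definition perp_rho_plus :: "'a::real_normed_vector rel" where
  "perp_rho_plus = {(x, y). rho_plus x y = 0}"

definition perp_rho_lambda :: "real \<Rightarrow> 'a::real_normed_vector rel" where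
  "perp_rho_lambda l = {(x, y). rho_lambda l x y = 0}"

(* The norm on the type of bounded linear maps is the operator norm. *)
definition support_functional :: "('a::real_normed_vector \<Rightarrow>\<^sub>L real) \<Rightarrow> 'a \<Rightarrow> bool" where
  "support_functional F x \<longleftrightarrow> norm F = 1 \<and> blinfun_apply F x = norm x"

definition smooth_at :: "'a::real_normed_vector \<Rightarrow> bool" where
  "smooth_at x \<longleftrightarrow> (\<exists>!F. support_functional F x)"

definition smooth_space :: "'a::real_normed_vector itself \<Rightarrow> bool" where
  "smooth_space _ \<longleftrightarrow> (\<forall>x::'a. x \<noteq> 0 \<longrightarrow> smooth_at x)"

(* Stated through independent sets because the library's dim is 0 on
   infinite-dimensional spaces, which are included here. *)
definition dim_at_least_2 :: "'a::real_normed_vector itself \<Rightarrow> bool" where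
  "dim_at_least_2 _ \<longleftrightarrow> (\<exists>B::'a set. independent B \<and> card B = 2)"

end

theory Submission
  imports Defs
begin

text \<open>
  Fix \<open>x \<noteq> 0\<close> and let \<open>p y\<close> be the right derivative at \<open>0\<close> of \<open>t \<mapsto> \<parallel>x + t y\<parallel>\<close>, so that
  \<open>\<rho>\<^sub>+(x, y) = \<parallel>x\<parallel> p y\<close> and \<open>\<rho>\<^sub>-(x, y) = - \<parallel>x\<parallel> p (- y)\<close>. All four conditions are
  equivalent to \<open>\<rho>\<^sub>- = \<rho>\<^sub>+\<close>, that is, to \<open>p\<close> being odd for every choice of \<open>x\<close>.

  For the orthogonality conditions the point is that \<open>\<rho>\<^sub>+\<close>, \<open>\<rho>\<^sub>-\<close> and hence \<open>\<rho>\<^sub>\<lambda>\<close> all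
  change by the same amount \<open>a \<parallel>x\<parallel>\<^sup>2\<close> when \<open>y\<close> is replaced by \<open>y + a x\<close>. One can therefore
  choose \<open>a\<close> so that either of \<open>\<rho>\<^sub>+\<close> and \<open>\<rho>\<^sub>\<lambda>\<close> vanishes at \<open>(x, y + a x)\<close>; an inclusion
  between the two relations makes the other vanish too, and then
  \<open>\<lambda> \<rho>\<^sub>-(x, y + a x) = 0\<close>. Since \<open>\<lambda> \<noteq> 0\<close>, the values of \<open>\<rho>\<^sub>-\<close> and \<open>\<rho>\<^sub>+\<close> agree at
  \<open>(x, y + a x)\<close>, and shifting back they agree at \<open>(x, y)\<close>.

  For smoothness, the functional \<open>p\<close> is sublinear, and the support functionals at \<open>x\<close> are
  exactly the linear functionals dominated by \<open>p\<close>. If \<open>p\<close> is odd, such a functional \<open>F\<close> is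
  squeezed by \<open>- p (- y) \<le> F y \<le> p y\<close>, so it is unique. Conversely, the Hahn--Banach theorem
  supplies support functionals with the values \<open>p y\<close> and \<open>- p (- y)\<close> at \<open>y\<close>; if there is
  only one support functional, these values coincide. The form of Hahn--Banach used here is
  obtained by taking, with Zorn's lemma, a minimal sublinear functional: minimality forces
  linearity.
\<close>

section \<open>Sublinear functionals\<close>

definition sublinear :: "('a::real_vector \<Rightarrow> real) \<Rightarrow> bool" where
  "sublinear p \<longleftrightarrow>
     (\<forall>x y. p (x + y) \<le> p x + p y) \<and> (\<forall>c x. 0 \<le> c \<longrightarrow> p (c *\<^sub>R x) = c * p x)"

lemma sublinear_add: "sublinear p \<Longrightarrow> p (x + y) \<le> p x + p y"
  and sublinear_scale: "sublinear p \<Longrightarrow> 0 \<le> c \<Longrightarrow> p (c *\<^sub>R x) = c * p x"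
  by (auto simp: sublinear_def)

lemma sublinear_zero: "sublinear p \<Longrightarrow> p 0 = 0"
  using sublinear_scale[of p 0 0] by simp

lemma sublinear_minus: "sublinear p \<Longrightarrow> - p (- x) \<le> p x"
  using sublinear_add[of p x "- x"] sublinear_zero[of p] by simp

text \<open>Requiring the homogeneity inequality for positive factors is enough, because the factor
  can be inverted.\<close>

lemma sublinearI:
  assumes add: "\<And>x y. p (x + y) \<le> p x + p y"
    and zero: "p 0 = 0"
    and scale: "\<And>c x. 0 < c \<Longrightarrow> p (c *\<^sub>R x) \<le> c * p x"
  shows "sublinear p"
proof -
  have "p (c *\<^sub>R x) = c * p x" if "0 \<le> c" for c x
  proof (cases "c = 0")
    case False
    with that have c: "0 < c" by simp
    have "p x \<le> inverse c * p (c *\<^sub>R x)"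
      using scale[of "inverse c" "c *\<^sub>R x"] c by simp
    then have "c * p x \<le> p (c *\<^sub>R x)"
      using c by (simp add: field_simps)
    with scale[OF c, of x] show ?thesis by simp
  qed (simp add: zero)
  with add show ?thesis by (auto simp: sublinear_def)
qed

text \<open>For sublinear \<open>p\<close>, this is the largest sublinear functional below \<open>p\<close> whose value at
  \<open>- y\<close> is at most \<open>- p y\<close>. Any linear functional below it is therefore squeezed to the value
  \<open>p y\<close> at \<open>y\<close>.\<close>

definition tighten :: "('a::real_vector \<Rightarrow> real) \<Rightarrow> 'a \<Rightarrow> 'a \<Rightarrow> real" where
  "tighten p y z = (INF t\<in>{0..}. p (z + t *\<^sub>R y) - t * p y)"

lemma tighten_lower_bound:
  assumes p: "sublinear p" and t: "0 \<le> t"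
  shows "- p (- z) \<le> p (z + t *\<^sub>R y) - t * p y"
proof -
  have "t * p y = p ((z + t *\<^sub>R y) + (- z))"
    using sublinear_scale[OF p t, of y] by simp
  also have "\<dots> \<le> p (z + t *\<^sub>R y) + p (- z)"
    by (rule sublinear_add[OF p])
  finally show ?thesis by simp
qed

lemma tighten_bdd_below:
  assumes "sublinear p"
  shows "bdd_below ((\<lambda>t. p (z + t *\<^sub>R y) - t * p y) ` {0..})"
  by (rule bdd_belowI2[where m = "- p (- z)"]) (use tighten_lower_bound[OF assms] in auto)

lemma tighten_le:
  assumes "sublinear p" "0 \<le> t"
  shows "tighten p y z \<le> p (z + t *\<^sub>R y) - t * p y"
  unfolding tighten_def by (rule cINF_lower[OF tighten_bdd_below]) (use assms in auto)

lemma le_tighten: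
  assumes "\<And>t. 0 \<le> t \<Longrightarrow> b \<le> p (z + t *\<^sub>R y) - t * p y"
  shows "b \<le> tighten p y z"
  unfolding tighten_def by (rule cINF_greatest) (use assms in auto)

lemma sublinear_tighten:
  assumes p: "sublinear p"
  shows "sublinear (tighten p y)"
proof (rule sublinearI)
  fix v w
  have "tighten p y (v + w) - (p (w + s *\<^sub>R y) - s * p y) \<le> p (v + t *\<^sub>R y) - t * p y"
    if st: "0 \<le> s" "0 \<le> t" for s t
  proof -
    have "tighten p y (v + w) \<le> p (v + w + (s + t) *\<^sub>R y) - (s + t) * p y"
      using st by (intro tighten_le[OF p]) simp
    moreover have "p (v + w + (s + t) *\<^sub>R y) \<le> p (v + t *\<^sub>R y) + p (w + s *\<^sub>R y)"
      using sublinear_add[OF p, of "v + t *\<^sub>R y" "w + s *\<^sub>R y"] by (simp add: algebra_simps)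
    ultimately show ?thesis by (simp add: algebra_simps)
  qed
  then have "tighten p y (v + w) - (p (w + s *\<^sub>R y) - s * p y) \<le> tighten p y v" if "0 \<le> s" for s
    using that by (intro le_tighten)
  then have "tighten p y (v + w) - tighten p y v \<le> p (w + s *\<^sub>R y) - s * p y" if "0 \<le> s" for s
    using that by (simp add: algebra_simps)
  then have "tighten p y (v + w) - tighten p y v \<le> tighten p y w"
    by (rule le_tighten)
  then show "tighten p y (v + w) \<le> tighten p y v + tighten p y w" by simp
next
  have "0 \<le> tighten p y 0"
    by (rule le_tighten) (simp add: sublinear_scale[OF p])
  with tighten_le[OF p, of 0 y 0] show "tighten p y 0 = 0"
    by (simp add: sublinear_zero[OF p])
next
  fix c :: real and v
  assume c: "0 < c"
  have "tighten p y (c *\<^sub>R v) / c \<le> p (v + t *\<^sub>R y) - t * p y" if t: "0 \<le> t" for t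
  proof -
    have "tighten p y (c *\<^sub>R v) \<le> p (c *\<^sub>R v + (c * t) *\<^sub>R y) - (c * t) * p y"
      using c t by (intro tighten_le[OF p]) simp
    also have "p (c *\<^sub>R v + (c * t) *\<^sub>R y) = c * p (v + t *\<^sub>R y)"
      using sublinear_scale[OF p, of c "v + t *\<^sub>R y"] c by (simp add: scaleR_add_right)
    finally show ?thesis using c by (simp add: field_simps)
  qed
  then have "tighten p y (c *\<^sub>R v) / c \<le> tighten p y v" by (rule le_tighten)
  then show "tighten p y (c *\<^sub>R v) \<le> c * tighten p y v"
    using c by (simp add: field_simps)
qed

text \<open>Pointwise infima of sublinear functionals are not subadditive in general: bounding the
  infimum at \<open>v + w\<close> by \<open>q v + r w\<close> needs one functional below both \<open>q\<close> and \<open>r\<close>, which a chain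
  provides. The common upper bound \<open>p\<close> keeps the infima finite, because
  \<open>- p (- z) \<le> - q (- z) \<le> q z\<close>.\<close>

lemma sublinear_INF_chain:
  assumes ne: "C \<noteq> {}"
    and sub: "\<And>q. q \<in> C \<Longrightarrow> sublinear q"
    and below: "\<And>q z. q \<in> C \<Longrightarrow> q z \<le> p z"
    and chain: "\<And>q r. q \<in> C \<Longrightarrow> r \<in> C \<Longrightarrow> q \<le> r \<or> r \<le> q"
  shows "sublinear (\<lambda>z. INF q\<in>C. q z)" and "\<And>q z. q \<in> C \<Longrightarrow> (INF q\<in>C. q z) \<le> q z"
proof -
  have "- p (- z) \<le> q z" if "q \<in> C" for q z
    using sublinear_minus[OF sub[OF that], of z] below[OF that, of "- z"] by linarith
  then have bdd: "bdd_below ((\<lambda>q. q z) ` C)" for z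
    by (rule bdd_belowI2)
  show lower: "(INF q\<in>C. q z) \<le> q z" if "q \<in> C" for q z
    by (rule cINF_lower[OF bdd that])
  show "sublinear (\<lambda>z. INF q\<in>C. q z)"
  proof (rule sublinearI)
    fix v w
    have "(INF q\<in>C. q (v + w)) - r w \<le> q v" if qr: "q \<in> C" "r \<in> C" for q r
    proof -
      obtain s where s: "s \<in> C" "s \<le> q" "s \<le> r"
        using chain[OF qr] qr by blast
      have "(INF q\<in>C. q (v + w)) \<le> s v + s w"
        using lower[OF s(1), of "v + w"] sublinear_add[OF sub[OF s(1)], of v w] by linarith
      with le_funD[OF s(2), of v] le_funD[OF s(3), of w] show ?thesis by linarith
    qed
    then have "(INF q\<in>C. q (v + w)) - r w \<le> (INF q\<in>C. q v)" if "r \<in> C" for r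
      using that by (intro cINF_greatest[OF ne])
    then have "(INF q\<in>C. q (v + w)) - (INF q\<in>C. q v) \<le> r w" if "r \<in> C" for r
      using that by (simp add: algebra_simps)
    then have "(INF q\<in>C. q (v + w)) - (INF q\<in>C. q v) \<le> (INF q\<in>C. q w)"
      by (rule cINF_greatest[OF ne])
    then show "(INF q\<in>C. q (v + w)) \<le> (INF q\<in>C. q v) + (INF q\<in>C. q w)" by simp
  next
    have "(\<lambda>q. q 0) ` C = {0}"
      using ne sublinear_zero[OF sub] by (force simp: image_iff)
    then show "(INF q\<in>C. q 0) = 0" by simp
  next
    fix c :: real and v
    assume c: "0 < c"
    have "(INF q\<in>C. q (c *\<^sub>R v)) / c \<le> q v" if "q \<in> C" for q
      using lower[OF that, of "c *\<^sub>R v"] sublinear_scale[OF sub[OF that], of c v] c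
      by (simp add: field_simps)
    then have "(INF q\<in>C. q (c *\<^sub>R v)) / c \<le> (INF q\<in>C. q v)"
      by (rule cINF_greatest[OF ne])
    then show "(INF q\<in>C. q (c *\<^sub>R v)) \<le> c * (INF q\<in>C. q v)"
      using c by (simp add: field_simps)
  qed
qed

lemma ex_minimal_sublinear:
  assumes p: "sublinear p"
  obtains m where "sublinear m" "m \<le> p" "\<And>q. sublinear q \<Longrightarrow> q \<le> m \<Longrightarrow> q = m"
proof -
  define A where "A = {q. sublinear q \<and> q \<le> p}"
  have po: "partial_order_on A (relation_of (\<lambda>q r. r \<le> q) A)"
    by (rule partial_order_on_relation_ofI) auto
  have "\<exists>m\<in>A. \<forall>q\<in>A. q \<le> m \<longrightarrow> q = m"
  proof (rule predicate_Zorn[OF po])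
    fix C assume "C \<in> Chains (relation_of (\<lambda>q r. r \<le> q) A)"
    then have CA: "C \<subseteq> A" and chain: "\<And>q r. q \<in> C \<Longrightarrow> r \<in> C \<Longrightarrow> q \<le> r \<or> r \<le> q"
      by (auto simp: Chains_def relation_of_def)
    show "\<exists>u\<in>A. \<forall>q\<in>C. u \<le> q"
    proof (cases "C = {}")
      case True
      with p show ?thesis by (auto simp: A_def)
    next
      case False
      have sub: "sublinear q" and below: "q z \<le> p z" if "q \<in> C" for q z
        using CA that by (auto simp: A_def le_fun_def)
      let ?u = "\<lambda>z. INF q\<in>C. q z"
      have u: "sublinear ?u"
        by (rule sublinear_INF_chain(1)[where p = p]) (use False sub below chain in blast)+
      have "?u z \<le> q z" if "q \<in> C" for q z
        by (rule sublinear_INF_chain(2)[where p = p]) (use False sub below chain that in blast)+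
      then have "?u \<le> q" if "q \<in> C" for q
        using that by (simp add: le_fun_def)
      moreover from this False have "?u \<le> p"
        using CA by (auto simp: A_def intro: order_trans)
      ultimately show ?thesis
        using u by (intro bexI[of _ ?u]) (auto simp: A_def)
    qed
  qed
  then obtain m where "m \<in> A" "\<forall>q\<in>A. q \<le> m \<longrightarrow> q = m" by blast
  then have "sublinear m" "m \<le> p" "\<And>q. sublinear q \<Longrightarrow> q \<le> m \<Longrightarrow> q = m"
    by (auto simp: A_def intro: order_trans)
  then show thesis by (rule that)
qed

text \<open>A minimal \<open>m\<close> agrees with every \<open>tighten m y\<close>. The bound given by the parameter \<open>t = 1\<close>
  in that infimum then reads \<open>m z \<le> m (z + y) - m y\<close>, which is superadditivity.\<close>

lemma minimal_sublinear_linear: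
  assumes m: "sublinear m" and min: "\<And>q. sublinear q \<Longrightarrow> q \<le> m \<Longrightarrow> q = m"
  shows "linear m"
proof -
  have "tighten m y = m" for y
    using tighten_le[OF m, of 0 y] by (intro min sublinear_tighten[OF m]) (simp add: le_fun_def)
  then have "m z + m y \<le> m (z + y)" for y z
    using tighten_le[OF m, of 1 y z] by simp
  then have add: "m (z + y) = m z + m y" for y z
    using sublinear_add[OF m, of z y] by (simp add: order_antisym)
  have minus: "m (- z) = - m z" for z
    using add[of z "- z"] sublinear_zero[OF m] by simp
  have "m (c *\<^sub>R z) = c * m z" for c z
  proof (cases "0 \<le> c")
    case True
    then show ?thesis by (rule sublinear_scale[OF m])
  next
    case False
    then show ?thesis
      using sublinear_scale[OF m, of "- c" z] minus[of "c *\<^sub>R z"] by simp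
  qed
  with add show ?thesis by (intro linearI) auto
qed

text \<open>Starting the descent from \<open>tighten p y\<close> rather than from \<open>p\<close> secures the value at \<open>y\<close>:
  the parameter \<open>t = 1\<close> gives \<open>f (- y) \<le> p 0 - p y\<close>.\<close>

theorem Hahn_Banach_sublinear:
  assumes p: "sublinear p"
  obtains f where "linear f" "\<And>z. f z \<le> p z" "f y = p y"
proof -
  obtain f where f: "sublinear f" "f \<le> tighten p y"
    and min: "\<And>q. sublinear q \<Longrightarrow> q \<le> f \<Longrightarrow> q = f"
    using ex_minimal_sublinear[OF sublinear_tighten[OF p]] by metis
  have lin: "linear f"
    by (rule minimal_sublinear_linear[OF f(1) min])
  have le: "f z \<le> p z" for z
    using le_funD[OF f(2), of z] tighten_le[OF p, of 0 y z] by simp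
  have "f (- y) \<le> - p y"
    using le_funD[OF f(2), of "- y"] tighten_le[OF p, of 1 y "- y"]
    by (simp add: sublinear_zero[OF p])
  then have "f y = p y"
    using le[of y] linear_neg[OF lin, of y] by simp
  with lin le show thesis by (rule that)
qed

section \<open>One-sided derivatives of the norm\<close>

definition norm_slope :: "'a::real_normed_vector \<Rightarrow> 'a \<Rightarrow> real \<Rightarrow> real" where
  "norm_slope x y t = (norm (x + t *\<^sub>R y) - norm x) / t"

definition norm_deriv :: "'a::real_normed_vector \<Rightarrow> 'a \<Rightarrow> real" where
  "norm_deriv x y = Lim (at_right 0) (norm_slope x y)"

text \<open>The slopes of a convex function increase: \<open>x + s y\<close> is the convex combination of \<open>x\<close>
  and \<open>x + t y\<close> with weights \<open>1 - s / t\<close> and \<open>s / t\<close>.\<close>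

lemma norm_slope_mono:
  assumes s: "0 < s" and st: "s \<le> t"
  shows "norm_slope x y s \<le> norm_slope x y t"
proof -
  have t: "0 < t" using s st by simp
  have "t *\<^sub>R (x + s *\<^sub>R y) = (t - s) *\<^sub>R x + s *\<^sub>R (x + t *\<^sub>R y)"
    by (simp add: algebra_simps)
  then have "norm (t *\<^sub>R (x + s *\<^sub>R y)) \<le> norm ((t - s) *\<^sub>R x) + norm (s *\<^sub>R (x + t *\<^sub>R y))"
    using norm_triangle_ineq by metis
  then have "t * norm (x + s *\<^sub>R y) \<le> (t - s) * norm x + s * norm (x + t *\<^sub>R y)"
    using s t st by simp
  then show ?thesis
    using s t by (simp add: norm_slope_def field_simps)
qed

lemma abs_norm_slope_le:
  assumes "0 < t"
  shows "\<bar>norm_slope x y t\<bar> \<le> norm y"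
proof -
  have "\<bar>norm (x + t *\<^sub>R y) - norm x\<bar> \<le> t * norm y"
    using norm_triangle_ineq3[of "x + t *\<^sub>R y" x] assms by simp
  then show ?thesis
    using assms by (simp add: norm_slope_def abs_divide field_simps)
qed

text \<open>Slopes that decrease as \<open>t\<close> decreases to \<open>0\<close> and are bounded below converge to their
  infimum.\<close>

lemma norm_slope_tendsto: "(norm_slope x y \<longlongrightarrow> norm_deriv x y) (at_right 0)"
proof -
  define L where "L = (INF t\<in>{0<..}. norm_slope x y t)"
  have bdd: "bdd_below (norm_slope x y ` {0<..})"
    by (rule bdd_belowI2[where m = "- norm y"]) (use abs_norm_slope_le[of _ x y] in \<open>auto simp: abs_le_iff minus_le_iff\<close>)
  have "(norm_slope x y \<longlongrightarrow> L) (at_right 0)"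
  proof (rule decreasing_tendsto)
    show "\<forall>\<^sub>F t in at_right 0. L \<le> norm_slope x y t"
      using eventually_at_right_less[of 0]
      by (rule eventually_mono) (auto simp: L_def intro!: cINF_lower[OF bdd])
  next
    fix b assume "L < b"
    then obtain s where s: "0 < s" "norm_slope x y s < b"
      using cINF_less_iff[OF _ bdd, of b] by (auto simp: L_def)
    have "norm_slope x y t < b" if "0 < t" "t < s" for t
      using norm_slope_mono[of t s x y] that s by simp
    then show "\<forall>\<^sub>F t in at_right 0. norm_slope x y t < b"
      using s(1) unfolding eventually_at_right_field by blast
  qed
  then show ?thesis
    unfolding norm_deriv_def by (simp add: tendsto_Lim)
qed

lemma rho_plus_eq: "rho_plus x y = norm x * norm_deriv x y"
  by (simp add: rho_plus_def norm_deriv_def norm_slope_def[abs_def])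

lemma rho_minus_eq: "rho_minus x y = - norm x * norm_deriv x (- y)"
proof -
  have "norm_slope x y (- t) = - norm_slope x (- y) t" for t
    by (simp add: norm_slope_def)
  then have "((\<lambda>t. norm_slope x y (- t)) \<longlongrightarrow> - norm_deriv x (- y)) (at_right 0)"
    by (simp add: tendsto_minus[OF norm_slope_tendsto])
  then have "(norm_slope x y \<longlongrightarrow> - norm_deriv x (- y)) (at_left 0)"
    by (simp add: filterlim_at_left_to_right)
  then show ?thesis
    by (simp add: rho_minus_def norm_slope_def[abs_def] tendsto_Lim)
qed

lemma norm_deriv_le_slope:
  assumes "0 < t"
  shows "norm_deriv x y \<le> norm_slope x y t"
proof (rule tendsto_upperbound[OF norm_slope_tendsto])
  show "\<forall>\<^sub>F s in at_right 0. norm_slope x y s \<le> norm_slope x y t"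
    unfolding eventually_at_right_field using assms norm_slope_mono[of _ t x y] by (meson less_imp_le)
qed simp

lemma norm_deriv_le_norm: "norm_deriv x y \<le> norm y"
  using norm_deriv_le_slope[of 1 x y] abs_norm_slope_le[of 1 x y] by simp

lemma norm_deriv_greatest:
  assumes "\<And>t. 0 < t \<Longrightarrow> b \<le> norm_slope x y t"
  shows "b \<le> norm_deriv x y"
  by (rule tendsto_lowerbound[OF norm_slope_tendsto])
    (use assms in \<open>auto intro: eventually_mono[OF eventually_at_right_less]\<close>)

text \<open>Subadditivity comes from the midpoint identity
  \<open>x + (r / 2) (v + w) = ((x + r v) + (x + r w)) / 2\<close>, where \<open>r\<close> is a common step not exceeding the
  steps \<open>t\<close> and \<open>s\<close> at which the two slopes are taken.\<close>

lemma sublinear_norm_deriv: "sublinear (norm_deriv x)"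
proof (rule sublinearI)
  fix v w
  have "norm_deriv x (v + w) - norm_slope x w s \<le> norm_slope x v t" if st: "0 < s" "0 < t" for s t
  proof -
    define r where "r = min s t"
    have r: "0 < r" "r \<le> s" "r \<le> t" using st by (auto simp: r_def)
    have "2 *\<^sub>R (x + (r/2) *\<^sub>R (v + w)) = (x + r *\<^sub>R v) + (x + r *\<^sub>R w)"
      by (simp add: algebra_simps scaleR_2)
    then have "2 * norm (x + (r/2) *\<^sub>R (v + w)) \<le> norm (x + r *\<^sub>R v) + norm (x + r *\<^sub>R w)"
      by (metis norm_scaleR norm_triangle_ineq abs_numeral)
    then have "norm_slope x (v + w) (r/2) \<le> norm_slope x v r + norm_slope x w r"
      using r(1) by (simp add: norm_slope_def divide_right_mono diff_divide_distrib[symmetric]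
          add_divide_distrib[symmetric])
    moreover have "norm_deriv x (v + w) \<le> norm_slope x (v + w) (r/2)"
      using r(1) by (intro norm_deriv_le_slope) simp
    ultimately show ?thesis
      using norm_slope_mono[OF r(1,2), of x w] norm_slope_mono[OF r(1,3), of x v] by linarith
  qed
  then have "norm_deriv x (v + w) - norm_slope x w s \<le> norm_deriv x v" if "0 < s" for s
    using that by (intro norm_deriv_greatest)
  then have "norm_deriv x (v + w) - norm_deriv x v \<le> norm_slope x w s" if "0 < s" for s
    using that by (simp add: algebra_simps)
  then have "norm_deriv x (v + w) - norm_deriv x v \<le> norm_deriv x w"
    by (rule norm_deriv_greatest)
  then show "norm_deriv x (v + w) \<le> norm_deriv x v + norm_deriv x w" by simp
next
  show "norm_deriv x 0 = 0"
    using norm_deriv_le_norm[of x 0] norm_deriv_greatest[of 0 x 0] by (simp add: norm_slope_def)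
next
  fix c :: real and v
  assume c: "0 < c"
  have "norm_deriv x (c *\<^sub>R v) / c \<le> norm_slope x v t" if t: "0 < t" for t
  proof -
    have "norm_deriv x (c *\<^sub>R v) \<le> norm_slope x (c *\<^sub>R v) (t / c)"
      using c t by (intro norm_deriv_le_slope) simp
    also have "\<dots> = c * norm_slope x v t"
      using c t by (simp add: norm_slope_def)
    finally show ?thesis using c by (simp add: field_simps)
  qed
  then have "norm_deriv x (c *\<^sub>R v) / c \<le> norm_deriv x v" by (rule norm_deriv_greatest)
  then show "norm_deriv x (c *\<^sub>R v) \<le> c * norm_deriv x v"
    using c by (simp add: field_simps)
qed

lemma norm_deriv_minus_self: "norm_deriv x (- x) \<le> - norm x"
  using norm_deriv_le_slope[of 1 x "- x"] by (simp add: norm_slope_def)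

lemma norm_deriv_scaled_self: "norm_deriv x (a *\<^sub>R x) = a * norm x"
proof -
  note sub = sublinear_norm_deriv[of x]
  have self: "norm_deriv x x = norm x" "norm_deriv x (- x) = - norm x"
    using norm_deriv_le_norm[of x x] norm_deriv_minus_self[of x] sublinear_minus[OF sub, of x]
    by linarith+
  show ?thesis
  proof (cases "0 \<le> a")
    case True
    then show ?thesis by (simp add: sublinear_scale[OF sub] self)
  next
    case False
    then show ?thesis using sublinear_scale[OF sub, of "- a" "- x"] by (simp add: self)
  qed
qed

text \<open>A sublinear functional that is linear on a line is additive along that line: apply
  subadditivity to \<open>y\<close> and \<open>a x\<close>, and to \<open>y + a x\<close> and \<open>- a x\<close>.\<close>

lemma norm_deriv_add_scaled_self: "norm_deriv x (y + a *\<^sub>R x) = norm_deriv x y + a * norm x"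
  using sublinear_add[OF sublinear_norm_deriv[of x], of y "a *\<^sub>R x"]
    sublinear_add[OF sublinear_norm_deriv[of x], of "y + a *\<^sub>R x" "(- a) *\<^sub>R x"]
    norm_deriv_scaled_self[of x a] norm_deriv_scaled_self[of x "- a"]
  by simp

section \<open>Support functionals and smoothness\<close>

lemma support_functional_le_norm_deriv:
  assumes "support_functional F x"
  shows "F y \<le> norm_deriv x y"
proof (rule norm_deriv_greatest)
  fix t :: real assume t: "0 < t"
  have "norm x + t * F y = F (x + t *\<^sub>R y)"
    using assms by (simp add: support_functional_def blinfun.add_right blinfun.scaleR_right)
  also have "\<dots> \<le> norm (x + t *\<^sub>R y)"
    using norm_blinfun[of F "x + t *\<^sub>R y"] assms by (simp add: support_functional_def)
  finally show "F y \<le> norm_slope x y t"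
    using t by (simp add: norm_slope_def field_simps)
qed

text \<open>A linear functional below the derivative of the norm is automatically a support
  functional: it is below the norm, and its value at \<open>- x\<close> is at most \<open>- \<parallel>x\<parallel>\<close>.\<close>

lemma ex_support_functional:
  fixes x :: "'a::real_normed_vector"
  assumes x: "x \<noteq> 0"
  obtains F where "support_functional F x" "blinfun_apply F y = norm_deriv x y"
proof -
  obtain f where f: "linear f" "\<And>z. f z \<le> norm_deriv x z" "f y = norm_deriv x y"
    using Hahn_Banach_sublinear[OF sublinear_norm_deriv[of x], of y] by metis
  have le: "f z \<le> norm z" for z
    using f(2)[of z] norm_deriv_le_norm[of x z] by linarith
  have bound: "\<bar>f z\<bar> \<le> norm z" for z
    using le[of z] le[of "- z"] linear_neg[OF f(1), of z] by simp
  have fx: "f x = norm x"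
    using le[of x] f(2)[of "- x"] norm_deriv_minus_self[of x] linear_neg[OF f(1), of x] by simp
  have "bounded_linear f"
    using f(1) bound by (intro bounded_linear_intro[where K = 1])
      (auto simp: linear_add linear_scale)
  then have app: "blinfun_apply (Blinfun f) = f"
    by (rule bounded_linear_Blinfun_apply)
  have "norm (Blinfun f) \<le> 1"
    by (rule norm_blinfun_bound) (simp_all add: app bound)
  moreover have "1 \<le> norm (Blinfun f)"
    using norm_blinfun[of "Blinfun f" x] x by (simp add: app fx)
  ultimately have "support_functional (Blinfun f) x"
    by (simp add: support_functional_def app fx)
  with f(3) show thesis by (intro that[of "Blinfun f"]) (simp_all add: app)
qed

lemma smooth_at_iff_norm_deriv_odd:
  assumes x: "x \<noteq> 0"
  shows "smooth_at x \<longleftrightarrow> (\<forall>y. norm_deriv x (- y) = - norm_deriv x y)"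
proof
  assume sm: "smooth_at x"
  show "\<forall>y. norm_deriv x (- y) = - norm_deriv x y"
  proof
    fix y
    obtain F where F: "support_functional F x" "F y = norm_deriv x y"
      using ex_support_functional[OF x] by metis
    obtain G where G: "support_functional G x" "G (- y) = norm_deriv x (- y)"
      using ex_support_functional[OF x] by metis
    have "F = G" using sm F(1) G(1) by (auto simp: smooth_at_def)
    with F(2) G(2) show "norm_deriv x (- y) = - norm_deriv x y"
      by (simp add: blinfun.minus_right)
  qed
next
  assume odd: "\<forall>y. norm_deriv x (- y) = - norm_deriv x y"
  have "F y = norm_deriv x y" if "support_functional F x" for F y
    using support_functional_le_norm_deriv[OF that, of y]
      support_functional_le_norm_deriv[OF that, of "- y"] odd[rule_format, of y]
    by (simp add: blinfun.minus_right)
  then have "F = G" if "support_functional F x" "support_functional G x" for F G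
    using that by (intro blinfun_eqI) simp
  moreover obtain F where "support_functional F x"
    using ex_support_functional[OF x] by metis
  ultimately show "smooth_at x"
    unfolding smooth_at_def by blast
qed

section \<open>Comparison of the orthogonality relations\<close>

lemma rho_add_scaled_self:
  shows rho_plus_add_scaled_self: "rho_plus x (y + a *\<^sub>R x) = rho_plus x y + a * (norm x)\<^sup>2"
    and rho_minus_add_scaled_self: "rho_minus x (y + a *\<^sub>R x) = rho_minus x y + a * (norm x)\<^sup>2"
proof -
  show "rho_plus x (y + a *\<^sub>R x) = rho_plus x y + a * (norm x)\<^sup>2"
    by (simp add: rho_plus_eq norm_deriv_add_scaled_self power2_eq_square algebra_simps)
  have "norm_deriv x (- (y + a *\<^sub>R x)) = norm_deriv x (- y) - a * norm x"
    using norm_deriv_add_scaled_self[of x "- y" "- a"] by simp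
  then show "rho_minus x (y + a *\<^sub>R x) = rho_minus x y + a * (norm x)\<^sup>2"
    by (simp only: rho_minus_eq power2_eq_square) (simp add: algebra_simps)
qed

lemma rho_lambda_add_scaled_self:
  "rho_lambda l x (y + a *\<^sub>R x) = rho_lambda l x y + a * (norm x)\<^sup>2"
  by (simp add: rho_lambda_def rho_add_scaled_self algebra_simps)

lemma rho_zero_left: "rho_plus 0 y = 0" "rho_minus 0 y = 0"
  by (simp_all add: rho_plus_def rho_minus_def)

lemma smooth_space_iff_rho:
  "smooth_space TYPE('a::real_normed_vector) \<longleftrightarrow> (\<forall>x y :: 'a. rho_minus x y = rho_plus x y)"
proof -
  have "smooth_at x \<longleftrightarrow> (\<forall>y. rho_minus x y = rho_plus x y)" if "x \<noteq> 0" for x :: 'a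
  proof -
    have "rho_minus x y = rho_plus x y \<longleftrightarrow> norm_deriv x (- y) = - norm_deriv x y" for y
      using that unfolding rho_minus_eq rho_plus_eq mult_minus_left mult_minus_right[symmetric]
        mult_cancel_left by auto
    with that show ?thesis by (simp add: smooth_at_iff_norm_deriv_odd)
  qed
  then show ?thesis
    unfolding smooth_space_def by (metis rho_zero_left)
qed

text \<open>At a common zero of \<open>\<rho>\<^sub>+\<close> and \<open>\<rho>\<^sub>\<lambda>\<close> also \<open>\<rho>\<^sub>-\<close> vanishes. As \<open>\<rho>\<^sub>+\<close> and \<open>\<rho>\<^sub>-\<close> change
  equally along \<open>x\<close>, one common zero on the line \<open>y + \<real> x\<close> makes them equal on that line.\<close>

lemma rho_eq_if_common_zero:
  assumes l: "l \<noteq> 0"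
    and zero: "rho_plus x (y + a *\<^sub>R x) = 0" "rho_lambda l x (y + a *\<^sub>R x) = 0"
  shows "rho_minus x y = rho_plus x y"
proof -
  have "rho_minus x (y + a *\<^sub>R x) = 0"
    using l zero by (simp add: rho_lambda_def)
  with zero(1) show ?thesis by (simp add: rho_add_scaled_self)
qed

theorem theorem2p12:
  fixes l :: real
  assumes "dim_at_least_2 TYPE('a::real_normed_vector)"
    and "0 < l" and "l \<le> 1"
  shows "((perp_rho_plus :: 'a rel) \<subseteq> perp_rho_lambda l
            \<longleftrightarrow> (perp_rho_lambda l :: 'a rel) \<subseteq> perp_rho_plus)
       \<and> ((perp_rho_lambda l :: 'a rel) \<subseteq> perp_rho_plus
            \<longleftrightarrow> (perp_rho_lambda l :: 'a rel) = perp_rho_plus)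
       \<and> ((perp_rho_lambda l :: 'a rel) = perp_rho_plus
            \<longleftrightarrow> smooth_space TYPE('a))"
proof -
  have l: "l \<noteq> 0" using assms(2) by simp
  let ?P = "perp_rho_plus :: 'a rel" and ?L = "perp_rho_lambda l :: 'a rel"
  have "rho_minus x y = rho_plus x y" if sub: "?P \<subseteq> ?L \<or> ?L \<subseteq> ?P" for x y :: 'a
  proof (cases "x = 0")
    case x: False
    from sub show ?thesis
    proof
      assume sub: "?P \<subseteq> ?L"
      define a where "a = - rho_plus x y / (norm x)\<^sup>2"
      have plus: "rho_plus x (y + a *\<^sub>R x) = 0"
        unfolding rho_plus_add_scaled_self using x by (simp add: a_def)
      with sub have "rho_lambda l x (y + a *\<^sub>R x) = 0"
        unfolding perp_rho_plus_def perp_rho_lambda_def by blast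
      with l plus show ?thesis by (rule rho_eq_if_common_zero)
    next
      assume sub: "?L \<subseteq> ?P"
      define a where "a = - rho_lambda l x y / (norm x)\<^sup>2"
      have lambda: "rho_lambda l x (y + a *\<^sub>R x) = 0"
        unfolding rho_lambda_add_scaled_self using x by (simp add: a_def)
      with sub have "rho_plus x (y + a *\<^sub>R x) = 0"
        unfolding perp_rho_plus_def perp_rho_lambda_def by blast
      with l show ?thesis using lambda by (rule rho_eq_if_common_zero)
    qed
  qed (simp add: rho_zero_left)
  then have "smooth_space TYPE('a)" if "?P \<subseteq> ?L \<or> ?L \<subseteq> ?P"
    using that unfolding smooth_space_iff_rho by blast
  moreover have "?L = ?P" if "smooth_space TYPE('a)"
    using that by (simp add: smooth_space_iff_rho perp_rho_plus_def perp_rho_lambda_def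
        rho_lambda_def algebra_simps)
  ultimately show ?thesis by blast
qed

end
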